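(* Let $\iota\colon\mathbf{A}\to\mathbf{B}$ be an isomorphism of commutative bimonoids, and let $e_A\colon\mathbf{A}\hookrightarrow\overline{\mathbf{A}}$ and $e_B\colon\mathbf{B}\hookrightarrow\overline{\mathbf{B}}$ be commutative admissible $\Delta_1$-extensions of $\mathbf{A}$ and $\mathbf{B}$. If $\overline{\mathbf{B}}$ is complete and complemented, then there is a unique complete embedding of bimonoids $\overline{\iota}\colon\overline{\mathbf{A}}\to\overline{\mathbf{B}}$ extending $\iota$, i.e.\ with $\overline{\iota}\circ e_A=e_B\circ\iota$.
   Context: A bimonoid $\langle A,\leq,\cdot,1,+,0\rangle$ is a poset with two monoid structures ($\cdot$ with unit $1$, $+$ with unit $0$), both operations order preserving in each argument, satisfying hemidistributivity $x\cdot(y+z)\leq(x\cdot y)+z$ and $(z+y)\cdot x\leq z+(y\cdot x)$; commutative if both operations are commutative. Homomorphisms preserve order, $\cdot,1,+,0$; embeddings are homomorphisms that are order embeddings; a complete embedding is an embedding preserving all existing joins and meets. In a commutative bimonoid, $y$ is a complement of $x$ if $x\cdot y\leq 0$ and $1\leq x+y$; it is unique when it exists and is written $\overline{x}$; the bimonoid is complemented if every element has a complement, and complete if its order is a complete lattice. A join $\bigvee X$ is admissible if $(\bigvee X)\cdot y=\bigvee\{x\cdot y: x\in X\}$ for all $y$; a meet $\bigwedge X$ is admissible if $(\bigwedge X)+y=\bigwedge\{x+y:x\in X\}$ for all $y$. An embedding $e\colon\mathbf{A}\hookrightarrow\mathbf{C}$ of commutative bimonoids is a commutative admissible $\Delta_1$-extension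 if every element of $\mathbf{C}$ is an admissible join of elements of the form $e(a)\cdot\overline{e(b)}$ ($a,b\in\mathbf{A}$, complement existing in $\mathbf{C}$) and an admissible meet of elements of the form $e(a)+\overline{e(b)}$. *)

theory Defs
  imports "HOL-Algebra.Complete_Lattice" "HOL-Algebra.Ring" "HOL-Library.FuncSet"
begin

text \<open>The record \<open>ring\<close> is used only as a signature, providing \<open>carrier\<close>, \<open>\<otimes>\<close>, \<open>\<one>\<close>, \<open>\<oplus>\<close>, \<open>\<zero>\<close>;
  no ring axioms are assumed.\<close>

record 'a bimonoid = "'a ring" +
  ble :: "'a \<Rightarrow> 'a \<Rightarrow> bool" (infixl \<open>\<preceq>\<index>\<close> 50)

definition order_of :: "('a, 'm) bimonoid_scheme \<Rightarrow> 'a gorder" where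
  "order_of A = \<lparr>carrier = carrier A, eq = (=), le = ble A\<rparr>"

locale bimonoid =
  fixes A (structure)
  assumes mult_monoid: "monoid A"
    and add_monoid: "monoid (add_monoid A)"
    and partial_order: "partial_order (order_of A)"
    and mult_mono: "\<lbrakk>x \<in> carrier A; x' \<in> carrier A; y \<in> carrier A; y' \<in> carrier A;
          x \<preceq> x'; y \<preceq> y'\<rbrakk> \<Longrightarrow> x \<otimes> y \<preceq> x' \<otimes> y'"
    and add_mono: "\<lbrakk>x \<in> carrier A; x' \<in> carrier A; y \<in> carrier A; y' \<in> carrier A;
          x \<preceq> x'; y \<preceq> y'\<rbrakk> \<Longrightarrow> x \<oplus> y \<preceq> x' \<oplus> y'"
    and hemidistrib_left: "\<lbrakk>x \<in> carrier A; y \<in> carrier A; z \<in> carrier A\<rbrakk>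
          \<Longrightarrow> x \<otimes> (y \<oplus> z) \<preceq> (x \<otimes> y) \<oplus> z"
    and hemidistrib_right: "\<lbrakk>x \<in> carrier A; y \<in> carrier A; z \<in> carrier A\<rbrakk>
          \<Longrightarrow> (z \<oplus> y) \<otimes> x \<preceq> z \<oplus> (y \<otimes> x)"

locale comm_bimonoid = bimonoid +
  assumes mult_comm: "\<lbrakk>x \<in> carrier A; y \<in> carrier A\<rbrakk> \<Longrightarrow> x \<otimes> y = y \<otimes> x"
    and add_comm: "\<lbrakk>x \<in> carrier A; y \<in> carrier A\<rbrakk> \<Longrightarrow> x \<oplus> y = y \<oplus> x"

definition bimonoid_hom :: "('a, 'm) bimonoid_scheme \<Rightarrow> ('b, 'n) bimonoid_scheme \<Rightarrow> ('a \<Rightarrow> 'b) \<Rightarrow> bool" where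
  "bimonoid_hom A B f \<longleftrightarrow>
     f \<in> carrier A \<rightarrow> carrier B \<and>
     (\<forall>x\<in>carrier A. \<forall>y\<in>carrier A. x \<preceq>\<^bsub>A\<^esub> y \<longrightarrow> f x \<preceq>\<^bsub>B\<^esub> f y) \<and>
     (\<forall>x\<in>carrier A. \<forall>y\<in>carrier A. f (x \<otimes>\<^bsub>A\<^esub> y) = f x \<otimes>\<^bsub>B\<^esub> f y) \<and> f \<one>\<^bsub>A\<^esub> = \<one>\<^bsub>B\<^esub> \<and>
     (\<forall>x\<in>carrier A. \<forall>y\<in>carrier A. f (x \<oplus>\<^bsub>A\<^esub> y) = f x \<oplus>\<^bsub>B\<^esub> f y) \<and> f \<zero>\<^bsub>A\<^esub> = \<zero>\<^bsub>B\<^esub>"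

definition bimonoid_embedding :: "('a, 'm) bimonoid_scheme \<Rightarrow> ('b, 'n) bimonoid_scheme \<Rightarrow> ('a \<Rightarrow> 'b) \<Rightarrow> bool" where
  "bimonoid_embedding A B f \<longleftrightarrow> bimonoid_hom A B f \<and>
     (\<forall>x\<in>carrier A. \<forall>y\<in>carrier A. x \<preceq>\<^bsub>A\<^esub> y \<longleftrightarrow> f x \<preceq>\<^bsub>B\<^esub> f y)"

definition bimonoid_iso :: "('a, 'm) bimonoid_scheme \<Rightarrow> ('b, 'n) bimonoid_scheme \<Rightarrow> ('a \<Rightarrow> 'b) \<Rightarrow> bool" where
  "bimonoid_iso A B f \<longleftrightarrow> bimonoid_embedding A B f \<and> bij_betw f (carrier A) (carrier B)"

abbreviation is_join :: "('a, 'm) bimonoid_scheme \<Rightarrow> 'a \<Rightarrow> 'a set \<Rightarrow> bool" where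
  "is_join A s X \<equiv> is_lub (order_of A) s X"

abbreviation is_meet :: "('a, 'm) bimonoid_scheme \<Rightarrow> 'a \<Rightarrow> 'a set \<Rightarrow> bool" where
  "is_meet A s X \<equiv> is_glb (order_of A) s X"

definition complete_embedding :: "('a, 'm) bimonoid_scheme \<Rightarrow> ('b, 'n) bimonoid_scheme \<Rightarrow> ('a \<Rightarrow> 'b) \<Rightarrow> bool" where
  "complete_embedding A B f \<longleftrightarrow> bimonoid_embedding A B f \<and>
     (\<forall>X s. X \<subseteq> carrier A \<longrightarrow> is_join A s X \<longrightarrow> is_join B (f s) (f ` X)) \<and>
     (\<forall>X s. X \<subseteq> carrier A \<longrightarrow> is_meet A s X \<longrightarrow> is_meet B (f s) (f ` X))"

definition is_complement :: "('a, 'm) bimonoid_scheme \<Rightarrow> 'a \<Rightarrow> 'a \<Rightarrow> bool" where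
  "is_complement A x y \<longleftrightarrow> x \<in> carrier A \<and> y \<in> carrier A \<and>
     x \<otimes>\<^bsub>A\<^esub> y \<preceq>\<^bsub>A\<^esub> \<zero>\<^bsub>A\<^esub> \<and> \<one>\<^bsub>A\<^esub> \<preceq>\<^bsub>A\<^esub> x \<oplus>\<^bsub>A\<^esub> y"

definition bcompl :: "('a, 'm) bimonoid_scheme \<Rightarrow> 'a \<Rightarrow> 'a" where
  "bcompl A x = (THE y. is_complement A x y)"

definition complemented :: "('a, 'm) bimonoid_scheme \<Rightarrow> bool" where
  "complemented A \<longleftrightarrow> (\<forall>x\<in>carrier A. \<exists>y. is_complement A x y)"

definition complete_bimonoid :: "('a, 'm) bimonoid_scheme \<Rightarrow> bool" where
  "complete_bimonoid A \<longleftrightarrow> complete_lattice (order_of A)"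

definition admissible_join :: "('a, 'm) bimonoid_scheme \<Rightarrow> 'a \<Rightarrow> 'a set \<Rightarrow> bool" where
  "admissible_join A s X \<longleftrightarrow> is_join A s X \<and>
     (\<forall>y\<in>carrier A. is_join A (s \<otimes>\<^bsub>A\<^esub> y) {x \<otimes>\<^bsub>A\<^esub> y | x. x \<in> X})"

definition admissible_meet :: "('a, 'm) bimonoid_scheme \<Rightarrow> 'a \<Rightarrow> 'a set \<Rightarrow> bool" where
  "admissible_meet A s X \<longleftrightarrow> is_meet A s X \<and>
     (\<forall>y\<in>carrier A. is_meet A (s \<oplus>\<^bsub>A\<^esub> y) {x \<oplus>\<^bsub>A\<^esub> y | x. x \<in> X})"

text \<open>The complement of every \<open>e b\<close> is required to exist in \<open>C\<close>. It would not be enough to restrict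
  the generating elements to those \<open>b\<close> for which it happens to exist: since \<open>\<zero>\<close> is
  the complement of \<open>\<one>\<close>, every commutative bimonoid would then be such an extension of itself.\<close>

definition comm_admissible_Delta1_extension ::
    "('a, 'm) bimonoid_scheme \<Rightarrow> ('c, 'n) bimonoid_scheme \<Rightarrow> ('a \<Rightarrow> 'c) \<Rightarrow> bool" where
  "comm_admissible_Delta1_extension A C e \<longleftrightarrow>
     comm_bimonoid A \<and> comm_bimonoid C \<and> bimonoid_embedding A C e \<and>
     (\<forall>b\<in>carrier A. \<exists>y. is_complement C (e b) y) \<and>
     (\<forall>c\<in>carrier C.
        (\<exists>X \<subseteq> {e a \<otimes>\<^bsub>C\<^esub> bcompl C (e b) | a b. a \<in> carrier A \<and> b \<in> carrier A}. admissible_join C c X) \<and>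
        (\<exists>X \<subseteq> {e a \<oplus>\<^bsub>C\<^esub> bcompl C (e b) | a b. a \<in> carrier A \<and> b \<in> carrier A}. admissible_meet C c X))"

lemma (in comm_bimonoid) complement_le:
  assumes "is_complement A x y" "is_complement A x z"
  shows "y \<preceq> z"
proof -
  interpret M: monoid A by (rule mult_monoid)
  interpret P: monoid "add_monoid A" by (rule add_monoid)
  interpret O: partial_order "order_of A" by (rule partial_order)
  have c: "x \<in> carrier A" "y \<in> carrier A" "z \<in> carrier A"
    and h: "x \<otimes> y \<preceq> \<zero>" "\<one> \<preceq> x \<oplus> z"
    using assms by (auto simp: is_complement_def)
  have cl: "\<And>u v. u \<in> carrier A \<Longrightarrow> v \<in> carrier A \<Longrightarrow> u \<oplus> v \<in> carrier A" "\<zero> \<in> carrier A"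
    using P.m_closed P.one_closed by auto
  have z0: "\<zero> \<oplus> z = z" using P.l_one c by simp
  have refl: "\<And>u. u \<in> carrier A \<Longrightarrow> u \<preceq> u"
    using O.le_refl by (simp add: order_of_def)
  have trans: "\<And>u v w. u \<preceq> v \<Longrightarrow> v \<preceq> w \<Longrightarrow> u \<in> carrier A \<Longrightarrow> v \<in> carrier A \<Longrightarrow> w \<in> carrier A \<Longrightarrow> u \<preceq> w"
    using O.le_trans by (simp add: order_of_def)
  have 1: "y \<preceq> y \<otimes> (x \<oplus> z)"
    using mult_mono[of y y \<one> "x \<oplus> z"] c h refl cl by simp
  have 2: "y \<otimes> (x \<oplus> z) \<preceq> (y \<otimes> x) \<oplus> z" using hemidistrib_left c by simp
  have 3: "(y \<otimes> x) \<oplus> z \<preceq> z"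
    using add_mono[of "y \<otimes> x" \<zero> z z] c h refl cl z0 mult_comm[of y x] by simp
  show ?thesis
    by (rule trans[OF trans[OF 1 2] 3]) (use c cl in auto)
qed

lemma (in comm_bimonoid) complement_unique:
  assumes "is_complement A x y" "is_complement A x z"
  shows "y = z"
proof -
  interpret O: partial_order "order_of A" by (rule partial_order)
  show ?thesis
    using O.le_antisym[of y z] complement_le[OF assms] complement_le[OF assms(2,1)] assms
    by (simp add: order_of_def is_complement_def)
qed

lemma (in comm_bimonoid) bcompl_eq: "is_complement A x y \<Longrightarrow> bcompl A x = y"
  unfolding bcompl_def by (blast intro: the_equality complement_unique)

end

theory Submission
  imports Defs
begin

text \<open>Composing with \<open>\<iota>\<close> turns both extensions into extensions of \<open>A\<close>. By residuation,
  \<open>e a \<cdot> \<not>e b \<le> e u + \<not>e v\<close> holds in an extension iff \<open>a \<cdot> v \<le> u + b\<close> holds in \<open>A\<close>, so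
  the comparison of join generators with meet generators depends on \<open>A\<close> only. An element \<open>c\<close>
  is determined by the set of (indices of) join generators below it and by the set of meet
  generators above it, and these two sets are polar to each other with respect to this relation.
  Completeness of the target provides, for every \<open>c\<close>, an element \<open>f c\<close> with the same two sets.
  Admissibility makes the sets of a product or sum computable from those of the
  factors or summands, so \<open>f\<close> is a homomorphism. It is the only one, because a homomorphism
  preserves complements, hence the join generators, and every element is a join of these.\<close>

section \<open>Commutative bimonoids\<close>

context comm_bimonoid
begin

section \<open>Monoid and order laws\<close>

lemma one_closed [simp]: "\<one> \<in> carrier A"
  and mult_closed [simp]: "\<lbrakk>x \<in> carrier A; y \<in> carrier A\<rbrakk> \<Longrightarrow> x \<otimes> y \<in> carrier A"
  and mult_one [simp]: "x \<in> carrier A \<Longrightarrow> x \<otimes> \<one> = x"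
  and one_mult [simp]: "x \<in> carrier A \<Longrightarrow> \<one> \<otimes> x = x"
  and mult_assoc: "\<lbrakk>x \<in> carrier A; y \<in> carrier A; z \<in> carrier A\<rbrakk>
    \<Longrightarrow> (x \<otimes> y) \<otimes> z = x \<otimes> (y \<otimes> z)"
proof -
  interpret M: monoid A by (rule mult_monoid)
  show "\<one> \<in> carrier A" "\<lbrakk>x \<in> carrier A; y \<in> carrier A\<rbrakk> \<Longrightarrow> x \<otimes> y \<in> carrier A"
    "x \<in> carrier A \<Longrightarrow> x \<otimes> \<one> = x" "x \<in> carrier A \<Longrightarrow> \<one> \<otimes> x = x"
    "\<lbrakk>x \<in> carrier A; y \<in> carrier A; z \<in> carrier A\<rbrakk> \<Longrightarrow> (x \<otimes> y) \<otimes> z = x \<otimes> (y \<otimes> z)"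
    by (auto simp: M.m_assoc)
qed

lemma zero_closed [simp]: "\<zero> \<in> carrier A"
  and add_closed [simp]: "\<lbrakk>x \<in> carrier A; y \<in> carrier A\<rbrakk> \<Longrightarrow> x \<oplus> y \<in> carrier A"
  and add_zero [simp]: "x \<in> carrier A \<Longrightarrow> x \<oplus> \<zero> = x"
  and zero_add [simp]: "x \<in> carrier A \<Longrightarrow> \<zero> \<oplus> x = x"
  and add_assoc: "\<lbrakk>x \<in> carrier A; y \<in> carrier A; z \<in> carrier A\<rbrakk>
    \<Longrightarrow> (x \<oplus> y) \<oplus> z = x \<oplus> (y \<oplus> z)"
proof -
  interpret P: monoid "add_monoid A" by (rule add_monoid)
  show "\<zero> \<in> carrier A" using P.one_closed by simp
  show "\<lbrakk>x \<in> carrier A; y \<in> carrier A\<rbrakk> \<Longrightarrow> x \<oplus> y \<in> carrier A" using P.m_closed by simp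
  show "x \<in> carrier A \<Longrightarrow> x \<oplus> \<zero> = x" using P.r_one by simp
  show "x \<in> carrier A \<Longrightarrow> \<zero> \<oplus> x = x" using P.l_one by simp
  show "\<lbrakk>x \<in> carrier A; y \<in> carrier A; z \<in> carrier A\<rbrakk> \<Longrightarrow> (x \<oplus> y) \<oplus> z = x \<oplus> (y \<oplus> z)"
    using P.m_assoc by simp
qed

lemma ble_refl [simp]: "x \<in> carrier A \<Longrightarrow> x \<preceq> x"
  and ble_trans: "\<lbrakk>x \<preceq> y; y \<preceq> z; x \<in> carrier A; y \<in> carrier A; z \<in> carrier A\<rbrakk> \<Longrightarrow> x \<preceq> z"
  and ble_antisym: "\<lbrakk>x \<preceq> y; y \<preceq> x; x \<in> carrier A; y \<in> carrier A\<rbrakk> \<Longrightarrow> x = y"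
proof -
  interpret O: partial_order "order_of A" by (rule partial_order)
  show "x \<in> carrier A \<Longrightarrow> x \<preceq> x" using O.le_refl by (simp add: order_of_def)
  show "\<lbrakk>x \<preceq> y; y \<preceq> z; x \<in> carrier A; y \<in> carrier A; z \<in> carrier A\<rbrakk> \<Longrightarrow> x \<preceq> z"
    using O.le_trans by (simp add: order_of_def)
  show "\<lbrakk>x \<preceq> y; y \<preceq> x; x \<in> carrier A; y \<in> carrier A\<rbrakk> \<Longrightarrow> x = y"
    using O.le_antisym by (simp add: order_of_def)
qed

section \<open>Complements: residuation and De Morgan\<close>

lemma is_complement_sym: "is_complement A x y \<Longrightarrow> is_complement A y x"
  by (auto simp: is_complement_def mult_comm add_comm)

text \<open>Each half of the complement condition gives one direction: multiply \<open>x\<close> by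
  \<open>y' \<oplus> y\<close>, which lies above \<open>\<one>\<close>, or multiply the inequality
  by \<open>y'\<close> and use \<open>y \<otimes> y' \<preceq> \<zero>\<close>. Hemidistributivity
  regroups the terms in both cases. All later comparisons of generators rest on this residuation
  law.\<close>

lemma mult_complement_le_iff:
  assumes "is_complement A y y'" "x \<in> carrier A" "z \<in> carrier A"
  shows "x \<otimes> y' \<preceq> z \<longleftrightarrow> x \<preceq> z \<oplus> y"
proof
  have c: "y \<in> carrier A" "y' \<in> carrier A" and h: "y \<otimes> y' \<preceq> \<zero>" "\<one> \<preceq> y' \<oplus> y"
    using assms(1) by (auto simp: is_complement_def add_comm)
  {
    assume *: "x \<otimes> y' \<preceq> z"
    have "x \<preceq> x \<otimes> (y' \<oplus> y)"
      using mult_mono[of x x \<one> "y' \<oplus> y"] assms c h by simp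
    moreover have "x \<otimes> (y' \<oplus> y) \<preceq> (x \<otimes> y') \<oplus> y"
      using hemidistrib_left assms c by simp
    moreover have "(x \<otimes> y') \<oplus> y \<preceq> z \<oplus> y"
      using * assms c by (intro add_mono) auto
    ultimately show "x \<preceq> z \<oplus> y"
      using assms c by (meson ble_trans mult_closed add_closed)
  }
  assume *: "x \<preceq> z \<oplus> y"
  have "x \<otimes> y' \<preceq> (z \<oplus> y) \<otimes> y'"
    using * assms c by (intro mult_mono) auto
  moreover have "(z \<oplus> y) \<otimes> y' \<preceq> z \<oplus> (y \<otimes> y')"
    using hemidistrib_right assms c by simp
  moreover have "z \<oplus> (y \<otimes> y') \<preceq> z"
    using add_mono[of z z "y \<otimes> y'" \<zero>] assms c h by simp
  ultimately show "x \<otimes> y' \<preceq> z"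
    using assms c by (meson ble_trans mult_closed add_closed)
qed

text \<open>Two successive residuations, first for \<open>x\<close> and then for \<open>y\<close>,
  reduce each half of the complement condition to commutativity: the first to
  \<open>x \<oplus> y \<preceq> y \<oplus> x\<close>, the second to
  \<open>y' \<otimes> x' \<preceq> x' \<otimes> y'\<close>.\<close>

lemma is_complement_add_mult:
  assumes "is_complement A x x'" "is_complement A y y'"
  shows "is_complement A (x \<oplus> y) (x' \<otimes> y')"
proof -
  have c: "x \<in> carrier A" "x' \<in> carrier A" "y \<in> carrier A" "y' \<in> carrier A"
    using assms by (auto simp: is_complement_def)
  have "(x \<oplus> y) \<otimes> x' \<preceq> y"
    using mult_complement_le_iff[OF assms(1), of "x \<oplus> y" y] c by (simp add: add_comm)
  then have "((x \<oplus> y) \<otimes> x') \<otimes> y' \<preceq> \<zero>"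
    using mult_complement_le_iff[OF assms(2), of "(x \<oplus> y) \<otimes> x'" \<zero>] c by simp
  moreover have "y' \<otimes> x' \<preceq> (x' \<otimes> y')"
    using c by (simp add: mult_comm)
  then have "y' \<preceq> (x' \<otimes> y') \<oplus> x"
    using mult_complement_le_iff[OF assms(1), of y' "x' \<otimes> y'"] c by simp
  \<comment> \<open>Inserting the unit gives \<open>y'\<close> a left factor, so that the second
    residuation can leave \<open>\<one>\<close> on the left.\<close>
  then have "\<one> \<otimes> y' \<preceq> (x' \<otimes> y') \<oplus> x"
    using c by simp
  then have "\<one> \<preceq> ((x' \<otimes> y') \<oplus> x) \<oplus> y"
    using mult_complement_le_iff[OF assms(2), of \<one> "(x' \<otimes> y') \<oplus> x"] c by simp
  then have "\<one> \<preceq> (x \<oplus> y) \<oplus> (x' \<otimes> y')"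
    using c by (simp add: add_assoc[of "x' \<otimes> y'"] add_comm[of "x \<oplus> y"])
  ultimately show ?thesis
    using c by (simp add: is_complement_def mult_assoc)
qed

section \<open>Joins and meets as one equivalence per test element\<close>

lemma is_join_iff:
  assumes "X \<subseteq> carrier A"
  shows "is_join A s X \<longleftrightarrow> s \<in> carrier A \<and> (\<forall>z\<in>carrier A. s \<preceq> z \<longleftrightarrow> (\<forall>x\<in>X. x \<preceq> z))"
proof -
  have "is_join A s X \<longleftrightarrow> s \<in> carrier A \<and> (\<forall>x\<in>X. x \<preceq> s) \<and>
      (\<forall>z\<in>carrier A. (\<forall>x\<in>X. x \<preceq> z) \<longrightarrow> s \<preceq> z)"
    using assms by (auto simp: least_def Upper_def order_of_def subset_iff)
  also have "\<dots> \<longleftrightarrow> s \<in> carrier A \<and> (\<forall>z\<in>carrier A. s \<preceq> z \<longleftrightarrow> (\<forall>x\<in>X. x \<preceq> z))"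
    using assms by (meson ble_refl ble_trans subsetD)
  finally show ?thesis .
qed

lemma is_meet_iff:
  assumes "X \<subseteq> carrier A"
  shows "is_meet A s X \<longleftrightarrow> s \<in> carrier A \<and> (\<forall>z\<in>carrier A. z \<preceq> s \<longleftrightarrow> (\<forall>x\<in>X. z \<preceq> x))"
proof -
  have "is_meet A s X \<longleftrightarrow> s \<in> carrier A \<and> (\<forall>x\<in>X. s \<preceq> x) \<and>
      (\<forall>z\<in>carrier A. (\<forall>x\<in>X. z \<preceq> x) \<longrightarrow> z \<preceq> s)"
    using assms by (auto simp: greatest_def Lower_def order_of_def subset_iff)
  also have "\<dots> \<longleftrightarrow> s \<in> carrier A \<and> (\<forall>z\<in>carrier A. z \<preceq> s \<longleftrightarrow> (\<forall>x\<in>X. z \<preceq> x))"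
    using assms by (meson ble_refl ble_trans subsetD)
  finally show ?thesis .
qed

lemma is_join_unique:
  "\<lbrakk>is_join A s X; is_join A t X; X \<subseteq> carrier A\<rbrakk> \<Longrightarrow> s = t"
  by (meson is_join_iff ble_antisym ble_refl)

end

section \<open>Generators of an admissible extension\<close>

text \<open>Generators are indexed by pairs from \<open>A\<close>, so that generators of different
  extensions share one index set.\<close>

definition join_gen :: "('c, 'n) bimonoid_scheme \<Rightarrow> ('a \<Rightarrow> 'c) \<Rightarrow> 'a \<times> 'a \<Rightarrow> 'c" where
  "join_gen C e p = e (fst p) \<otimes>\<^bsub>C\<^esub> bcompl C (e (snd p))"

definition meet_gen :: "('c, 'n) bimonoid_scheme \<Rightarrow> ('a \<Rightarrow> 'c) \<Rightarrow> 'a \<times> 'a \<Rightarrow> 'c" where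
  "meet_gen C e q = e (fst q) \<oplus>\<^bsub>C\<^esub> bcompl C (e (snd q))"

definition gen_rel :: "('a, 'm) bimonoid_scheme \<Rightarrow> 'a \<times> 'a \<Rightarrow> 'a \<times> 'a \<Rightarrow> bool" where
  "gen_rel A p q \<longleftrightarrow> fst p \<otimes>\<^bsub>A\<^esub> snd q \<preceq>\<^bsub>A\<^esub> fst q \<oplus>\<^bsub>A\<^esub> snd p"

text \<open>The index of a product of join generators. Second components are added because by De
  Morgan a product of complements is the complement of a sum; \<open>add_pair\<close> is the dual
  for meet generators.\<close>

definition mult_pair :: "('a, 'm) bimonoid_scheme \<Rightarrow> 'a \<times> 'a \<Rightarrow> 'a \<times> 'a \<Rightarrow> 'a \<times> 'a" where
  "mult_pair A p p' = (fst p \<otimes>\<^bsub>A\<^esub> fst p', snd p \<oplus>\<^bsub>A\<^esub> snd p')"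

definition add_pair :: "('a, 'm) bimonoid_scheme \<Rightarrow> 'a \<times> 'a \<Rightarrow> 'a \<times> 'a \<Rightarrow> 'a \<times> 'a" where
  "add_pair A q q' = (fst q \<oplus>\<^bsub>A\<^esub> fst q', snd q \<otimes>\<^bsub>A\<^esub> snd q')"

text \<open>Indices are collected instead of the generators themselves, which makes the sets of
  elements of two extensions directly comparable.\<close>

definition lower_gens ::
    "('a, 'm) bimonoid_scheme \<Rightarrow> ('c, 'n) bimonoid_scheme \<Rightarrow> ('a \<Rightarrow> 'c) \<Rightarrow> 'c \<Rightarrow> ('a \<times> 'a) set" where
  "lower_gens A C e c = {p \<in> carrier A \<times> carrier A. join_gen C e p \<preceq>\<^bsub>C\<^esub> c}"

definition upper_gens ::
    "('a, 'm) bimonoid_scheme \<Rightarrow> ('c, 'n) bimonoid_scheme \<Rightarrow> ('a \<Rightarrow> 'c) \<Rightarrow> 'c \<Rightarrow> ('a \<times> 'a) set" where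
  "upper_gens A C e c = {q \<in> carrier A \<times> carrier A. c \<preceq>\<^bsub>C\<^esub> meet_gen C e q}"

locale Delta1_extension =
  fixes A :: "('a, 'm) bimonoid_scheme" and C :: "('c, 'n) bimonoid_scheme" and e :: "'a \<Rightarrow> 'c"
  assumes extension: "comm_admissible_Delta1_extension A C e"
begin

sublocale A: comm_bimonoid A
  using extension by (simp add: comm_admissible_Delta1_extension_def)

sublocale C: comm_bimonoid C
  using extension by (simp add: comm_admissible_Delta1_extension_def)

abbreviation "low \<equiv> lower_gens A C e"
abbreviation "up \<equiv> upper_gens A C e"

section \<open>The embedding and the complements of its image\<close>

lemma e_closed [simp]: "a \<in> carrier A \<Longrightarrow> e a \<in> carrier C"
  and e_le_iff: "\<lbrakk>a \<in> carrier A; b \<in> carrier A\<rbrakk> \<Longrightarrow> e a \<preceq>\<^bsub>C\<^esub> e b \<longleftrightarrow> a \<preceq>\<^bsub>A\<^esub> b"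
  and e_mult: "\<lbrakk>a \<in> carrier A; b \<in> carrier A\<rbrakk> \<Longrightarrow> e (a \<otimes>\<^bsub>A\<^esub> b) = e a \<otimes>\<^bsub>C\<^esub> e b"
  and e_add: "\<lbrakk>a \<in> carrier A; b \<in> carrier A\<rbrakk> \<Longrightarrow> e (a \<oplus>\<^bsub>A\<^esub> b) = e a \<oplus>\<^bsub>C\<^esub> e b"
  and e_one: "e \<one>\<^bsub>A\<^esub> = \<one>\<^bsub>C\<^esub>"
  and e_zero: "e \<zero>\<^bsub>A\<^esub> = \<zero>\<^bsub>C\<^esub>"
  using extension
  by (auto simp: comm_admissible_Delta1_extension_def bimonoid_embedding_def bimonoid_hom_def)

text \<open>\<open>bcompl\<close> is a definite description; here it denotes a complement because
  the extension provides one for every \<open>e a\<close> and complements are unique.\<close>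

lemma compl_e: "a \<in> carrier A \<Longrightarrow> is_complement C (e a) (bcompl C (e a))"
  using extension C.bcompl_eq by (fastforce simp: comm_admissible_Delta1_extension_def)

lemma compl_e_closed [simp]: "a \<in> carrier A \<Longrightarrow> bcompl C (e a) \<in> carrier C"
  using compl_e by (simp add: is_complement_def)

lemma join_gen_closed [simp]: "p \<in> carrier A \<times> carrier A \<Longrightarrow> join_gen C e p \<in> carrier C"
  by (auto simp: join_gen_def)

lemma meet_gen_closed [simp]: "q \<in> carrier A \<times> carrier A \<Longrightarrow> meet_gen C e q \<in> carrier C"
  by (auto simp: meet_gen_def)

lemma mult_pair_closed [simp]:
  "\<lbrakk>p \<in> carrier A \<times> carrier A; p' \<in> carrier A \<times> carrier A\<rbrakk> \<Longrightarrow> mult_pair A p p' \<in> carrier A \<times> carrier A"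
  by (auto simp: mult_pair_def)

lemma add_pair_closed [simp]:
  "\<lbrakk>q \<in> carrier A \<times> carrier A; q' \<in> carrier A \<times> carrier A\<rbrakk> \<Longrightarrow> add_pair A q q' \<in> carrier A \<times> carrier A"
  by (auto simp: add_pair_def)

text \<open>Residuation with the roles of an element and its complement exchanged, since in a meet
  generator the complement is the summand.\<close>

lemma le_meet_gen_iff:
  assumes "x \<in> carrier C" "q \<in> carrier A \<times> carrier A"
  shows "x \<preceq>\<^bsub>C\<^esub> meet_gen C e q \<longleftrightarrow> x \<otimes>\<^bsub>C\<^esub> e (snd q) \<preceq>\<^bsub>C\<^esub> e (fst q)"
  using assms C.mult_complement_le_iff[OF C.is_complement_sym[OF compl_e], of "snd q" x "e (fst q)"]
  by (auto simp: meet_gen_def)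

lemma join_gen_le_iff:
  assumes "x \<in> carrier C" "p \<in> carrier A \<times> carrier A"
  shows "join_gen C e p \<preceq>\<^bsub>C\<^esub> x \<longleftrightarrow> e (fst p) \<preceq>\<^bsub>C\<^esub> x \<oplus>\<^bsub>C\<^esub> e (snd p)"
  using assms C.mult_complement_le_iff[OF compl_e, of "snd p" "e (fst p)" x]
  by (auto simp: join_gen_def)

text \<open>Residuation carries each complement to the other side, where it turns into the element
  itself. Only images of elements of \<open>A\<close> remain, and \<open>e\<close> reflects the
  order.\<close>

lemma join_gen_le_meet_gen_iff:
  assumes "p \<in> carrier A \<times> carrier A" "q \<in> carrier A \<times> carrier A"
  shows "join_gen C e p \<preceq>\<^bsub>C\<^esub> meet_gen C e q \<longleftrightarrow> gen_rel A p q"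
proof -
  obtain a b u v where pq: "p = (a, b)" "q = (u, v)" by (cases p, cases q)
  then have c: "a \<in> carrier A" "b \<in> carrier A" "u \<in> carrier A" "v \<in> carrier A"
    using assms by auto
  let ?v = "bcompl C (e v)"
  have "join_gen C e p \<preceq>\<^bsub>C\<^esub> meet_gen C e q \<longleftrightarrow> e a \<preceq>\<^bsub>C\<^esub> (e u \<oplus>\<^bsub>C\<^esub> ?v) \<oplus>\<^bsub>C\<^esub> e b"
    using join_gen_le_iff[of "meet_gen C e q" p] assms by (simp add: pq meet_gen_def)
  \<comment> \<open>With the summands regrouped, the right side is the meet generator with index
    \<open>(u \<oplus> b, v)\<close>, to which residuation applies once more.\<close>
  also have "(e u \<oplus>\<^bsub>C\<^esub> ?v) \<oplus>\<^bsub>C\<^esub> e b = e (u \<oplus>\<^bsub>A\<^esub> b) \<oplus>\<^bsub>C\<^esub> ?v"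
    using c by (simp add: e_add C.add_assoc C.add_comm[of ?v])
  also have "e a \<preceq>\<^bsub>C\<^esub> \<dots> \<longleftrightarrow> e (a \<otimes>\<^bsub>A\<^esub> v) \<preceq>\<^bsub>C\<^esub> e (u \<oplus>\<^bsub>A\<^esub> b)"
    using le_meet_gen_iff[of "e a" "(u \<oplus>\<^bsub>A\<^esub> b, v)"] c by (simp add: meet_gen_def e_mult)
  also have "\<dots> \<longleftrightarrow> gen_rel A p q"
    using c by (simp add: gen_rel_def pq e_le_iff)
  finally show ?thesis .
qed

section \<open>Products and sums of generators\<close>

lemma bcompl_e_add:
  "\<lbrakk>a \<in> carrier A; b \<in> carrier A\<rbrakk>
    \<Longrightarrow> bcompl C (e a \<oplus>\<^bsub>C\<^esub> e b) = bcompl C (e a) \<otimes>\<^bsub>C\<^esub> bcompl C (e b)"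
  by (intro C.bcompl_eq C.is_complement_add_mult compl_e)

text \<open>De Morgan for the sum of the two complements, read backwards by the symmetry of
  complementation.\<close>

lemma bcompl_e_mult:
  "\<lbrakk>a \<in> carrier A; b \<in> carrier A\<rbrakk>
    \<Longrightarrow> bcompl C (e a \<otimes>\<^bsub>C\<^esub> e b) = bcompl C (e a) \<oplus>\<^bsub>C\<^esub> bcompl C (e b)"
  by (intro C.bcompl_eq C.is_complement_sym[OF C.is_complement_add_mult] C.is_complement_sym[OF compl_e])

lemma join_gen_mult_pair:
  assumes "p \<in> carrier A \<times> carrier A" "p' \<in> carrier A \<times> carrier A"
  shows "join_gen C e (mult_pair A p p') = join_gen C e p \<otimes>\<^bsub>C\<^esub> join_gen C e p'"
proof -
  have swap: "(a \<otimes>\<^bsub>C\<^esub> b) \<otimes>\<^bsub>C\<^esub> (c \<otimes>\<^bsub>C\<^esub> d) = (a \<otimes>\<^bsub>C\<^esub> c) \<otimes>\<^bsub>C\<^esub> (b \<otimes>\<^bsub>C\<^esub> d)"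
    if "a \<in> carrier C" "b \<in> carrier C" "c \<in> carrier C" "d \<in> carrier C" for a b c d
    using that by (metis C.mult_assoc C.mult_comm C.mult_closed)
  show ?thesis
    using assms by (auto simp: join_gen_def mult_pair_def e_mult e_add bcompl_e_add swap)
qed

lemma meet_gen_add_pair:
  assumes "q \<in> carrier A \<times> carrier A" "q' \<in> carrier A \<times> carrier A"
  shows "meet_gen C e (add_pair A q q') = meet_gen C e q \<oplus>\<^bsub>C\<^esub> meet_gen C e q'"
proof -
  have swap: "(a \<oplus>\<^bsub>C\<^esub> b) \<oplus>\<^bsub>C\<^esub> (c \<oplus>\<^bsub>C\<^esub> d) = (a \<oplus>\<^bsub>C\<^esub> c) \<oplus>\<^bsub>C\<^esub> (b \<oplus>\<^bsub>C\<^esub> d)"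
    if "a \<in> carrier C" "b \<in> carrier C" "c \<in> carrier C" "d \<in> carrier C" for a b c d
    using that by (metis C.add_assoc C.add_comm C.add_closed)
  show ?thesis
    using assms by (auto simp: meet_gen_def add_pair_def e_mult e_add bcompl_e_mult swap)
qed

section \<open>Density of the generators and admissibility\<close>

lemma join_gens_exist:
  assumes "c \<in> carrier C"
  obtains X where "X \<subseteq> join_gen C e ` (carrier A \<times> carrier A)" "admissible_join C c X"
proof -
  have "{e a \<otimes>\<^bsub>C\<^esub> bcompl C (e b) | a b. a \<in> carrier A \<and> b \<in> carrier A}
      = join_gen C e ` (carrier A \<times> carrier A)"
    by (force simp: join_gen_def)
  then show ?thesis
    using extension assms that by (auto simp: comm_admissible_Delta1_extension_def)
qed

lemma meet_gens_exist:
  assumes "c \<in> carrier C"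
  obtains X where "X \<subseteq> meet_gen C e ` (carrier A \<times> carrier A)" "admissible_meet C c X"
proof -
  have "{e a \<oplus>\<^bsub>C\<^esub> bcompl C (e b) | a b. a \<in> carrier A \<and> b \<in> carrier A}
      = meet_gen C e ` (carrier A \<times> carrier A)"
    by (force simp: meet_gen_def)
  then show ?thesis
    using extension assms that by (auto simp: comm_admissible_Delta1_extension_def)
qed

text \<open>Some set \<open>X\<close> of join generators has \<open>x\<close> as an admissible join.
  Its members lie below \<open>x\<close>, so they are indexed by \<open>low x\<close>; the other
  generators below \<open>x\<close> do no harm by monotonicity. The full set \<open>low x\<close>
  thus replaces the unspecified \<open>X\<close>.\<close>

lemma mult_le_iff_low:
  assumes "x \<in> carrier C" "y \<in> carrier C" "z \<in> carrier C"
  shows "x \<otimes>\<^bsub>C\<^esub> y \<preceq>\<^bsub>C\<^esub> z \<longleftrightarrow> (\<forall>p\<in>low x. join_gen C e p \<otimes>\<^bsub>C\<^esub> y \<preceq>\<^bsub>C\<^esub> z)"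
proof
  assume *: "x \<otimes>\<^bsub>C\<^esub> y \<preceq>\<^bsub>C\<^esub> z"
  show "\<forall>p\<in>low x. join_gen C e p \<otimes>\<^bsub>C\<^esub> y \<preceq>\<^bsub>C\<^esub> z"
  proof
    fix p assume "p \<in> low x"
    then have p: "p \<in> carrier A \<times> carrier A" "join_gen C e p \<preceq>\<^bsub>C\<^esub> x"
      by (auto simp: lower_gens_def)
    then have "join_gen C e p \<otimes>\<^bsub>C\<^esub> y \<preceq>\<^bsub>C\<^esub> x \<otimes>\<^bsub>C\<^esub> y"
      using assms by (intro C.mult_mono) auto
    then show "join_gen C e p \<otimes>\<^bsub>C\<^esub> y \<preceq>\<^bsub>C\<^esub> z"
      using C.ble_trans[OF _ *] p(1) assms by simp
  qed
next
  assume *: "\<forall>p\<in>low x. join_gen C e p \<otimes>\<^bsub>C\<^esub> y \<preceq>\<^bsub>C\<^esub> z"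
  obtain X where X: "X \<subseteq> join_gen C e ` (carrier A \<times> carrier A)" "admissible_join C x X"
    using join_gens_exist assms by blast
  then have XC: "X \<subseteq> carrier C" using join_gen_closed by blast
  have "is_join C x X" "is_join C (x \<otimes>\<^bsub>C\<^esub> y) {w \<otimes>\<^bsub>C\<^esub> y | w. w \<in> X}"
    using X(2) assms by (auto simp: admissible_join_def)
  moreover have "{w \<otimes>\<^bsub>C\<^esub> y | w. w \<in> X} \<subseteq> carrier C" using XC assms by auto
  ultimately have "\<forall>w\<in>X. w \<preceq>\<^bsub>C\<^esub> x"
      and le: "x \<otimes>\<^bsub>C\<^esub> y \<preceq>\<^bsub>C\<^esub> z \<longleftrightarrow> (\<forall>w\<in>X. w \<otimes>\<^bsub>C\<^esub> y \<preceq>\<^bsub>C\<^esub> z)"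
    using XC assms by (auto simp: C.is_join_iff)
  then have "\<forall>w\<in>X. \<exists>p\<in>low x. w = join_gen C e p"
    using X(1) by (fastforce simp: lower_gens_def)
  then show "x \<otimes>\<^bsub>C\<^esub> y \<preceq>\<^bsub>C\<^esub> z" using * le by auto
qed

text \<open>The order dual of \<open>mult_le_iff_low\<close>, from admissible meets.\<close>

lemma le_add_iff_up:
  assumes "x \<in> carrier C" "y \<in> carrier C" "z \<in> carrier C"
  shows "z \<preceq>\<^bsub>C\<^esub> x \<oplus>\<^bsub>C\<^esub> y \<longleftrightarrow> (\<forall>q\<in>up x. z \<preceq>\<^bsub>C\<^esub> meet_gen C e q \<oplus>\<^bsub>C\<^esub> y)"
proof
  assume *: "z \<preceq>\<^bsub>C\<^esub> x \<oplus>\<^bsub>C\<^esub> y"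
  show "\<forall>q\<in>up x. z \<preceq>\<^bsub>C\<^esub> meet_gen C e q \<oplus>\<^bsub>C\<^esub> y"
  proof
    fix q assume "q \<in> up x"
    then have q: "q \<in> carrier A \<times> carrier A" "x \<preceq>\<^bsub>C\<^esub> meet_gen C e q"
      by (auto simp: upper_gens_def)
    then have "x \<oplus>\<^bsub>C\<^esub> y \<preceq>\<^bsub>C\<^esub> meet_gen C e q \<oplus>\<^bsub>C\<^esub> y"
      using assms by (intro C.add_mono) auto
    then show "z \<preceq>\<^bsub>C\<^esub> meet_gen C e q \<oplus>\<^bsub>C\<^esub> y"
      using C.ble_trans[OF *] q(1) assms by simp
  qed
next
  assume *: "\<forall>q\<in>up x. z \<preceq>\<^bsub>C\<^esub> meet_gen C e q \<oplus>\<^bsub>C\<^esub> y"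
  obtain X where X: "X \<subseteq> meet_gen C e ` (carrier A \<times> carrier A)" "admissible_meet C x X"
    using meet_gens_exist assms by blast
  then have XC: "X \<subseteq> carrier C" using meet_gen_closed by blast
  have "is_meet C x X" "is_meet C (x \<oplus>\<^bsub>C\<^esub> y) {w \<oplus>\<^bsub>C\<^esub> y | w. w \<in> X}"
    using X(2) assms by (auto simp: admissible_meet_def)
  moreover have "{w \<oplus>\<^bsub>C\<^esub> y | w. w \<in> X} \<subseteq> carrier C" using XC assms by auto
  ultimately have "\<forall>w\<in>X. x \<preceq>\<^bsub>C\<^esub> w"
      and le: "z \<preceq>\<^bsub>C\<^esub> x \<oplus>\<^bsub>C\<^esub> y \<longleftrightarrow> (\<forall>w\<in>X. z \<preceq>\<^bsub>C\<^esub> w \<oplus>\<^bsub>C\<^esub> y)"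
    using XC assms by (auto simp: C.is_meet_iff)
  then have "\<forall>w\<in>X. \<exists>q\<in>up x. w = meet_gen C e q"
    using X(1) by (fastforce simp: upper_gens_def)
  then show "z \<preceq>\<^bsub>C\<^esub> x \<oplus>\<^bsub>C\<^esub> y" using * le by auto
qed

lemma low_carrier: "p \<in> low x \<Longrightarrow> p \<in> carrier A \<times> carrier A"
  by (simp add: lower_gens_def)

lemma up_carrier: "q \<in> up x \<Longrightarrow> q \<in> carrier A \<times> carrier A"
  by (simp add: upper_gens_def)

text \<open>The instance of \<open>mult_le_iff_low\<close> at the unit \<open>\<one>\<close>: join
  generators are join-dense.\<close>

lemma le_iff_join_gens:
  assumes "x \<in> carrier C" "z \<in> carrier C"
  shows "x \<preceq>\<^bsub>C\<^esub> z \<longleftrightarrow> (\<forall>p\<in>low x. join_gen C e p \<preceq>\<^bsub>C\<^esub> z)"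
  using mult_le_iff_low[of x "\<one>\<^bsub>C\<^esub>" z] assms low_carrier by simp

lemma le_iff_meet_gens:
  assumes "x \<in> carrier C" "z \<in> carrier C"
  shows "z \<preceq>\<^bsub>C\<^esub> x \<longleftrightarrow> (\<forall>q\<in>up x. z \<preceq>\<^bsub>C\<^esub> meet_gen C e q)"
  using le_add_iff_up[of x "\<zero>\<^bsub>C\<^esub>" z] assms up_carrier by simp

lemma is_join_low:
  assumes "x \<in> carrier C"
  shows "is_join C x (join_gen C e ` low x)"
proof -
  have "join_gen C e ` low x \<subseteq> carrier C" using low_carrier by auto
  then show ?thesis using assms by (simp add: C.is_join_iff le_iff_join_gens[of x])
qed

section \<open>Elements as sets of generator indices\<close>

lemma le_iff_low:
  assumes "x \<in> carrier C" "y \<in> carrier C"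
  shows "x \<preceq>\<^bsub>C\<^esub> y \<longleftrightarrow> low x \<subseteq> low y"
  using le_iff_join_gens[OF assms] by (auto simp: lower_gens_def)

lemma le_iff_up:
  assumes "x \<in> carrier C" "y \<in> carrier C"
  shows "x \<preceq>\<^bsub>C\<^esub> y \<longleftrightarrow> up y \<subseteq> up x"
  using le_iff_meet_gens[OF assms(2,1)] by (auto simp: upper_gens_def)

lemma eq_if_up_eq:
  "\<lbrakk>x \<in> carrier C; y \<in> carrier C; up x = up y\<rbrakk> \<Longrightarrow> x = y"
  by (rule C.ble_antisym) (auto simp: le_iff_up)

lemma eq_if_low_eq:
  "\<lbrakk>x \<in> carrier C; y \<in> carrier C; low x = low y\<rbrakk> \<Longrightarrow> x = y"
  by (rule C.ble_antisym) (auto simp: le_iff_low)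

text \<open>By join-density, \<open>x\<close> lies below a meet generator iff all join generators
  below \<open>x\<close> do, and each such comparison is decided by \<open>gen_rel A\<close>. With
  \<open>low_eq_polar\<close>, either index set determines the other by a rule that does not mention
  \<open>C\<close>.\<close>

lemma up_eq_polar:
  assumes "x \<in> carrier C"
  shows "up x = {q \<in> carrier A \<times> carrier A. \<forall>p\<in>low x. gen_rel A p q}"
proof -
  have "x \<preceq>\<^bsub>C\<^esub> meet_gen C e q \<longleftrightarrow> (\<forall>p\<in>low x. gen_rel A p q)" if "q \<in> carrier A \<times> carrier A" for q
    using le_iff_join_gens[OF assms meet_gen_closed[OF that]] join_gen_le_meet_gen_iff[OF _ that]
      low_carrier by blast
  then show ?thesis by (auto simp: upper_gens_def)
qed

lemma low_eq_polar:
  assumes "x \<in> carrier C"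
  shows "low x = {p \<in> carrier A \<times> carrier A. \<forall>q\<in>up x. gen_rel A p q}"
proof -
  have "join_gen C e p \<preceq>\<^bsub>C\<^esub> x \<longleftrightarrow> (\<forall>q\<in>up x. gen_rel A p q)" if "p \<in> carrier A \<times> carrier A" for p
    using le_iff_meet_gens[OF assms join_gen_closed[OF that]] join_gen_le_meet_gen_iff[OF that]
      up_carrier by blast
  then show ?thesis by (auto simp: lower_gens_def)
qed

text \<open>Admissibility is applied to one factor after the other, and the resulting products of
  join generators are again join generators. Upper sets are the ones obtained directly, since
  admissible joins control what lies above a product.\<close>

lemma up_mult:
  assumes "x \<in> carrier C" "y \<in> carrier C"
  shows "up (x \<otimes>\<^bsub>C\<^esub> y) =
    {q \<in> carrier A \<times> carrier A. \<forall>p\<in>low x. \<forall>p'\<in>low y. gen_rel A (mult_pair A p p') q}"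
proof -
  have "x \<otimes>\<^bsub>C\<^esub> y \<preceq>\<^bsub>C\<^esub> meet_gen C e q \<longleftrightarrow> (\<forall>p\<in>low x. \<forall>p'\<in>low y. gen_rel A (mult_pair A p p') q)"
    if q: "q \<in> carrier A \<times> carrier A" for q
  proof -
    have "join_gen C e p \<otimes>\<^bsub>C\<^esub> y \<preceq>\<^bsub>C\<^esub> meet_gen C e q
        \<longleftrightarrow> (\<forall>p'\<in>low y. gen_rel A (mult_pair A p p') q)" if "p \<in> low x" for p
    proof -
      have p: "p \<in> carrier A \<times> carrier A" using that low_carrier by blast
      \<comment> \<open>\<open>mult_le_iff_low\<close> expands the left factor only, so
        commutativity first brings \<open>y\<close> to the left.\<close>
      have "join_gen C e p \<otimes>\<^bsub>C\<^esub> y \<preceq>\<^bsub>C\<^esub> meet_gen C e q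
          \<longleftrightarrow> (\<forall>p'\<in>low y. join_gen C e p' \<otimes>\<^bsub>C\<^esub> join_gen C e p \<preceq>\<^bsub>C\<^esub> meet_gen C e q)"
        using mult_le_iff_low[of y "join_gen C e p"] p q assms
        by (simp add: C.mult_comm[of "join_gen C e p"])
      also have "\<dots> \<longleftrightarrow> (\<forall>p'\<in>low y. gen_rel A (mult_pair A p p') q)"
      proof (rule ball_cong[OF refl])
        fix p' assume "p' \<in> low y"
        then have p': "p' \<in> carrier A \<times> carrier A" by (rule low_carrier)
        have "join_gen C e p' \<otimes>\<^bsub>C\<^esub> join_gen C e p = join_gen C e (mult_pair A p p')"
          using p p' by (metis join_gen_mult_pair C.mult_comm join_gen_closed)
        then show "join_gen C e p' \<otimes>\<^bsub>C\<^esub> join_gen C e p \<preceq>\<^bsub>C\<^esub> meet_gen C e q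
            \<longleftrightarrow> gen_rel A (mult_pair A p p') q"
          using p p' q by (metis join_gen_le_meet_gen_iff mult_pair_closed)
      qed
      finally show ?thesis .
    qed
    then show ?thesis using mult_le_iff_low[of x y "meet_gen C e q"] q assms by auto
  qed
  then show ?thesis by (auto simp: upper_gens_def)
qed

text \<open>The dual of \<open>up_mult\<close>: admissible meets control what lies below a sum, so
  here it is the lower set.\<close>

lemma low_add:
  assumes "x \<in> carrier C" "y \<in> carrier C"
  shows "low (x \<oplus>\<^bsub>C\<^esub> y) =
    {p \<in> carrier A \<times> carrier A. \<forall>q\<in>up x. \<forall>q'\<in>up y. gen_rel A p (add_pair A q q')}"
proof -
  have "join_gen C e p \<preceq>\<^bsub>C\<^esub> x \<oplus>\<^bsub>C\<^esub> y \<longleftrightarrow> (\<forall>q\<in>up x. \<forall>q'\<in>up y. gen_rel A p (add_pair A q q'))"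
    if p: "p \<in> carrier A \<times> carrier A" for p
  proof -
    have "join_gen C e p \<preceq>\<^bsub>C\<^esub> meet_gen C e q \<oplus>\<^bsub>C\<^esub> y
        \<longleftrightarrow> (\<forall>q'\<in>up y. gen_rel A p (add_pair A q q'))" if "q \<in> up x" for q
    proof -
      have q: "q \<in> carrier A \<times> carrier A" using that up_carrier by blast
      have "join_gen C e p \<preceq>\<^bsub>C\<^esub> meet_gen C e q \<oplus>\<^bsub>C\<^esub> y
          \<longleftrightarrow> (\<forall>q'\<in>up y. join_gen C e p \<preceq>\<^bsub>C\<^esub> meet_gen C e q' \<oplus>\<^bsub>C\<^esub> meet_gen C e q)"
        using le_add_iff_up[of y "meet_gen C e q"] p q assms
        by (simp add: C.add_comm[of "meet_gen C e q"])
      also have "\<dots> \<longleftrightarrow> (\<forall>q'\<in>up y. gen_rel A p (add_pair A q q'))"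
      proof (rule ball_cong[OF refl])
        fix q' assume "q' \<in> up y"
        then have q': "q' \<in> carrier A \<times> carrier A" by (rule up_carrier)
        have "meet_gen C e q' \<oplus>\<^bsub>C\<^esub> meet_gen C e q = meet_gen C e (add_pair A q q')"
          using q q' by (metis meet_gen_add_pair C.add_comm meet_gen_closed)
        then show "join_gen C e p \<preceq>\<^bsub>C\<^esub> meet_gen C e q' \<oplus>\<^bsub>C\<^esub> meet_gen C e q
            \<longleftrightarrow> gen_rel A p (add_pair A q q')"
          using p q q' by (metis join_gen_le_meet_gen_iff add_pair_closed)
      qed
      finally show ?thesis .
    qed
    then show ?thesis using le_add_iff_up[of x y "join_gen C e p"] p assms by auto
  qed
  then show ?thesis by (auto simp: lower_gens_def)
qed

text \<open>Residuation against a meet generator leaves images of elements of \<open>A\<close> only.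
  The set is therefore the same in every extension of \<open>A\<close>, which forces a map
  preserving upper sets to respect the two embeddings.\<close>

lemma up_e:
  assumes "a \<in> carrier A"
  shows "up (e a) = {q \<in> carrier A \<times> carrier A. a \<otimes>\<^bsub>A\<^esub> snd q \<preceq>\<^bsub>A\<^esub> fst q}"
proof -
  have "e a \<preceq>\<^bsub>C\<^esub> meet_gen C e q \<longleftrightarrow> a \<otimes>\<^bsub>A\<^esub> snd q \<preceq>\<^bsub>A\<^esub> fst q"
    if "q \<in> carrier A \<times> carrier A" for q
    using that assms le_meet_gen_iff[of "e a" q] e_le_iff[of "a \<otimes>\<^bsub>A\<^esub> snd q" "fst q"]
    by (auto simp: e_mult)
  then show ?thesis by (auto simp: upper_gens_def)
qed

text \<open>The explicit restriction to pairs from the carrier covers the empty \<open>X\<close>,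
  whose join is the least element.\<close>

lemma up_join:
  assumes "is_join C s X" "X \<subseteq> carrier C"
  shows "up s = {q \<in> carrier A \<times> carrier A. \<forall>x\<in>X. q \<in> up x}"
  using assms by (auto simp: upper_gens_def C.is_join_iff)

lemma low_meet:
  assumes "is_meet C s X" "X \<subseteq> carrier C"
  shows "low s = {p \<in> carrier A \<times> carrier A. \<forall>x\<in>X. p \<in> low x}"
  using assms by (auto simp: lower_gens_def C.is_meet_iff)

end

section \<open>Comparing two extensions\<close>

locale two_Delta1_extensions =
  C: Delta1_extension A C e + D: Delta1_extension A D g
  for A :: "('a, 'm) bimonoid_scheme" and C :: "('c, 'n) bimonoid_scheme" and e
    and D :: "('d, 'k) bimonoid_scheme" and g
begin

text \<open>Order, products, sums, images of \<open>A\<close>, joins and meets are all expressed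
  through index sets by rules that read the same in \<open>C\<close> and \<open>D\<close>.
  Preserving upper sets therefore preserves all of them.\<close>

lemma complete_embedding_if_up_eq:
  assumes f: "\<And>c. c \<in> carrier C \<Longrightarrow> f c \<in> carrier D"
    and up: "\<And>c. c \<in> carrier C \<Longrightarrow> D.up (f c) = C.up c"
  shows "complete_embedding C D f" "\<forall>a\<in>carrier A. f (e a) = g a"
proof -
  \<comment> \<open>Lower sets are the polars of upper sets on both sides.\<close>
  have low: "D.low (f c) = C.low c" if "c \<in> carrier C" for c
    using that f by (simp add: C.low_eq_polar D.low_eq_polar up)
  show fe: "\<forall>a\<in>carrier A. f (e a) = g a"
    by (auto intro!: D.eq_if_up_eq simp: f up C.up_e D.up_e)
  have le: "x \<preceq>\<^bsub>C\<^esub> y \<longleftrightarrow> f x \<preceq>\<^bsub>D\<^esub> f y" if "x \<in> carrier C" "y \<in> carrier C" for x y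
    using that f by (simp add: C.le_iff_up D.le_iff_up up)
  \<comment> \<open>The rule for products yields upper sets and the rule for sums lower sets, hence
    the two different criteria for equality.\<close>
  have "f (x \<otimes>\<^bsub>C\<^esub> y) = f x \<otimes>\<^bsub>D\<^esub> f y" if "x \<in> carrier C" "y \<in> carrier C" for x y
    using that by (intro D.eq_if_up_eq) (auto simp: f up low C.up_mult D.up_mult)
  moreover have "f (x \<oplus>\<^bsub>C\<^esub> y) = f x \<oplus>\<^bsub>D\<^esub> f y" if "x \<in> carrier C" "y \<in> carrier C" for x y
    using that by (intro D.eq_if_low_eq) (auto simp: f up low C.low_add D.low_add)
  \<comment> \<open>The units of \<open>C\<close> and \<open>D\<close> are the images of the units
    of \<open>A\<close>.\<close>
  moreover have "f \<one>\<^bsub>C\<^esub> = \<one>\<^bsub>D\<^esub>" "f \<zero>\<^bsub>C\<^esub> = \<zero>\<^bsub>D\<^esub>"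
    using fe C.e_one D.e_one C.e_zero D.e_zero C.A.one_closed C.A.zero_closed by metis+
  ultimately have emb: "bimonoid_embedding C D f"
    using le f by (auto simp: bimonoid_embedding_def bimonoid_hom_def)
  have "is_join D (f s) (f ` X)" if X: "X \<subseteq> carrier C" and s: "is_join C s X" for X s
  proof -
    have sC: "s \<in> carrier C" and fX: "f ` X \<subseteq> carrier D"
      using s X f by (auto simp: C.C.is_join_iff)
    \<comment> \<open>The test element \<open>z\<close> ranges over all of \<open>D\<close>, also
      outside the image of \<open>f\<close>. Its upper set is still a set of pairs from
      \<open>A\<close>, so it can be compared with \<open>C.up s\<close>, the intersection of the
      sets \<open>C.up x\<close>.\<close>
    have "f s \<preceq>\<^bsub>D\<^esub> z \<longleftrightarrow> (\<forall>x\<in>X. f x \<preceq>\<^bsub>D\<^esub> z)" if z: "z \<in> carrier D" for z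
    proof -
      have "f s \<preceq>\<^bsub>D\<^esub> z \<longleftrightarrow> D.up z \<subseteq> C.up s"
        using sC z f by (simp add: D.le_iff_up up)
      also have "\<dots> \<longleftrightarrow> (\<forall>x\<in>X. D.up z \<subseteq> C.up x)"
        using D.up_carrier by (auto simp: C.up_join[OF s X])
      also have "\<dots> \<longleftrightarrow> (\<forall>x\<in>X. f x \<preceq>\<^bsub>D\<^esub> z)"
        using X z f by (auto simp: D.le_iff_up up subset_iff)
      finally show ?thesis .
    qed
    then show ?thesis using D.C.is_join_iff[OF fX] sC f by auto
  qed
  moreover have "is_meet D (f s) (f ` X)" if X: "X \<subseteq> carrier C" and s: "is_meet C s X" for X s
  proof -
    have sC: "s \<in> carrier C" and fX: "f ` X \<subseteq> carrier D"
      using s X f by (auto simp: C.C.is_meet_iff)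
    have "z \<preceq>\<^bsub>D\<^esub> f s \<longleftrightarrow> (\<forall>x\<in>X. z \<preceq>\<^bsub>D\<^esub> f x)" if z: "z \<in> carrier D" for z
    proof -
      have "z \<preceq>\<^bsub>D\<^esub> f s \<longleftrightarrow> D.low z \<subseteq> C.low s"
        using sC z f by (simp add: D.le_iff_low low)
      also have "\<dots> \<longleftrightarrow> (\<forall>x\<in>X. D.low z \<subseteq> C.low x)"
        using D.low_carrier by (auto simp: C.low_meet[OF s X])
      also have "\<dots> \<longleftrightarrow> (\<forall>x\<in>X. z \<preceq>\<^bsub>D\<^esub> f x)"
        using X z f by (auto simp: D.le_iff_low low subset_iff)
      finally show ?thesis .
    qed
    then show ?thesis using D.C.is_meet_iff[OF fX] sC f by auto
  qed
  ultimately show "complete_embedding C D f"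
    using emb by (simp add: complete_embedding_def)
qed

text \<open>The witness is the join in \<open>D\<close> of those generators of \<open>D\<close>
  whose indices lie in \<open>C.low c\<close>. It is below a meet generator iff all of these are, so
  its upper set is the polar of \<open>C.low c\<close>, which is \<open>C.up c\<close>.\<close>

lemma ex_up_eq:
  assumes "complete_bimonoid D" "c \<in> carrier C"
  shows "\<exists>d\<in>carrier D. D.up d = C.up c"
proof -
  let ?X = "join_gen D g ` C.low c"
  have X: "?X \<subseteq> carrier D" using C.low_carrier by auto
  interpret L: complete_lattice "order_of D"
    using assms(1) by (simp add: complete_bimonoid_def)
  obtain d where "is_join D d ?X"
    using L.sup_exists[of ?X] X by (auto simp: order_of_def)
  then have d: "d \<in> carrier D" "\<And>z. z \<in> carrier D \<Longrightarrow> d \<preceq>\<^bsub>D\<^esub> z \<longleftrightarrow> (\<forall>x\<in>?X. x \<preceq>\<^bsub>D\<^esub> z)"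
    using X by (auto simp: D.C.is_join_iff)
  have "d \<preceq>\<^bsub>D\<^esub> meet_gen D g q \<longleftrightarrow> (\<forall>p\<in>C.low c. gen_rel A p q)" if "q \<in> carrier A \<times> carrier A" for q
    using d(2)[OF D.meet_gen_closed[OF that]] D.join_gen_le_meet_gen_iff[OF _ that]
      C.low_carrier by blast
  then have "D.up d = {q \<in> carrier A \<times> carrier A. \<forall>p\<in>C.low c. gen_rel A p q}"
    by (auto simp: upper_gens_def)
  then show ?thesis using d(1) assms(2) C.up_eq_polar by auto
qed

lemma complete_embedding_unique:
  assumes f: "complete_embedding C D f" "\<forall>a\<in>carrier A. f (e a) = g a"
    and h: "complete_embedding C D h" "\<forall>a\<in>carrier A. h (e a) = g a"
    and c: "c \<in> carrier C"
  shows "f c = h c"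
proof -
  have gen: "k (join_gen C e p) = join_gen D g p"
    if k: "complete_embedding C D k" "\<forall>a\<in>carrier A. k (e a) = g a"
      and p: "p \<in> carrier A \<times> carrier A" for k p
  proof -
    have hom: "bimonoid_hom C D k"
      using k(1) by (simp add: complete_embedding_def bimonoid_embedding_def)
    \<comment> \<open>Being a complement is a pair of inequalities between bimonoid terms, and
      \<open>k\<close> preserves these.\<close>
    have compl: "is_complement D (k x) (k y)" if "is_complement C x y" for x y
    proof -
      have xy: "x \<in> carrier C" "y \<in> carrier C" "x \<otimes>\<^bsub>C\<^esub> y \<preceq>\<^bsub>C\<^esub> \<zero>\<^bsub>C\<^esub>" "\<one>\<^bsub>C\<^esub> \<preceq>\<^bsub>C\<^esub> x \<oplus>\<^bsub>C\<^esub> y"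
        using that by (auto simp: is_complement_def)
      then have "k (x \<otimes>\<^bsub>C\<^esub> y) \<preceq>\<^bsub>D\<^esub> k \<zero>\<^bsub>C\<^esub>" "k \<one>\<^bsub>C\<^esub> \<preceq>\<^bsub>D\<^esub> k (x \<oplus>\<^bsub>C\<^esub> y)"
        using hom C.C.mult_closed C.C.add_closed C.C.one_closed C.C.zero_closed
        unfolding bimonoid_hom_def by blast+
      then show ?thesis
        using hom xy by (auto simp: bimonoid_hom_def is_complement_def)
    qed
    \<comment> \<open>Uniqueness of complements in \<open>D\<close> identifies the image of the
      complement.\<close>
    have "bcompl D (g b) = k (bcompl C (e b))" if "b \<in> carrier A" for b
      using compl[OF C.compl_e] that k(2) by (intro D.C.bcompl_eq) auto
    then show ?thesis
      using p hom k(2) by (auto simp: join_gen_def bimonoid_hom_def)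
  qed
  have sub: "join_gen C e ` C.low c \<subseteq> carrier C" "join_gen D g ` C.low c \<subseteq> carrier D"
    using C.low_carrier by auto
  \<comment> \<open>The set on the right does not mention \<open>k\<close>, so the values of any two
    such maps at \<open>c\<close> are joins of one set.\<close>
  have "is_join D (k c) (join_gen D g ` C.low c)"
    if k: "complete_embedding C D k" "\<forall>a\<in>carrier A. k (e a) = g a" for k
  proof -
    have "is_join D (k c) (k ` join_gen C e ` C.low c)"
      using k(1) C.is_join_low[OF c] sub(1) by (simp add: complete_embedding_def)
    moreover have "k ` join_gen C e ` C.low c = join_gen D g ` C.low c"
      unfolding image_image using gen[OF k] C.low_carrier by (intro image_cong) auto
    ultimately show ?thesis by simp
  qed
  then show ?thesis
    using f h sub(2) D.C.is_join_unique by blast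
qed

text \<open>Extensionality fixes the values outside \<open>carrier C\<close>, so that agreement on
  the carrier becomes equality of functions. The witness is a choice function for
  \<open>ex_up_eq\<close>, restricted to the carrier.\<close>

lemma ex1_complete_embedding:
  assumes "complete_bimonoid D"
  shows "\<exists>!f. f \<in> extensional (carrier C) \<and> complete_embedding C D f \<and>
           (\<forall>a\<in>carrier A. f (e a) = g a)"
proof -
  obtain f0 where f0: "\<And>c. c \<in> carrier C \<Longrightarrow> f0 c \<in> carrier D \<and> D.up (f0 c) = C.up c"
    using ex_up_eq[OF assms] by metis
  let ?f = "restrict f0 (carrier C)"
  have f: "complete_embedding C D ?f" "\<forall>a\<in>carrier A. ?f (e a) = g a"
    using f0 by (intro complete_embedding_if_up_eq; simp)+
  show ?thesis
  proof (rule ex1I[of _ ?f])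
    show "?f \<in> extensional (carrier C) \<and> complete_embedding C D ?f \<and>
        (\<forall>a\<in>carrier A. ?f (e a) = g a)"
      using f by simp
    fix h assume "h \<in> extensional (carrier C) \<and> complete_embedding C D h \<and>
        (\<forall>a\<in>carrier A. h (e a) = g a)"
    then show "h = ?f"
      using complete_embedding_unique[OF _ _ f]
      by (intro extensionalityI[of _ "carrier C"]) auto
  qed
qed

end

section \<open>Transport of an extension along an isomorphism\<close>

lemma Delta1_extension_comp_iso:
  fixes A :: "('a, 'm) bimonoid_scheme" and D :: "('d, 'n) bimonoid_scheme"
  assumes "comm_bimonoid A" and iso: "bimonoid_iso A B \<iota>"
    and ext: "comm_admissible_Delta1_extension B D e"
  shows "comm_admissible_Delta1_extension A D (e \<circ> \<iota>)"
proof -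
  have im: "\<iota> ` carrier A = carrier B"
    using iso by (auto simp: bimonoid_iso_def bij_betw_def)
  then have cl: "\<iota> a \<in> carrier B" if "a \<in> carrier A" for a using that by blast
  have emb: "bimonoid_embedding A D (e \<circ> \<iota>)"
  proof -
    have "bimonoid_embedding A B \<iota>" "bimonoid_embedding B D e"
      using iso ext by (auto simp: comm_admissible_Delta1_extension_def bimonoid_iso_def)
    note emb = this[unfolded bimonoid_embedding_def]
    then have le: "x \<preceq>\<^bsub>A\<^esub> y \<longleftrightarrow> e (\<iota> x) \<preceq>\<^bsub>D\<^esub> e (\<iota> y)"
      if "x \<in> carrier A" "y \<in> carrier A" for x y
      using cl that by metis
    have "e (\<iota> (x \<otimes>\<^bsub>A\<^esub> y)) = e (\<iota> x) \<otimes>\<^bsub>D\<^esub> e (\<iota> y) \<and> e (\<iota> (x \<oplus>\<^bsub>A\<^esub> y)) = e (\<iota> x) \<oplus>\<^bsub>D\<^esub> e (\<iota> y)"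
      if "x \<in> carrier A" "y \<in> carrier A" for x y
      using emb[THEN conjunct1] cl that unfolding bimonoid_hom_def by metis
    moreover have "e (\<iota> \<one>\<^bsub>A\<^esub>) = \<one>\<^bsub>D\<^esub>" "e (\<iota> \<zero>\<^bsub>A\<^esub>) = \<zero>\<^bsub>D\<^esub>"
      and "\<forall>x\<in>carrier A. e (\<iota> x) \<in> carrier D"
      using emb[THEN conjunct1] cl by (auto simp: bimonoid_hom_def)
    ultimately show ?thesis
      by (simp add: bimonoid_embedding_def bimonoid_hom_def flip: le)
  qed
  \<comment> \<open>Surjectivity of \<open>\<iota>\<close> keeps the generating sets unchanged. The
    operation \<open>F\<close> stands for both forms of generators, products and sums with a
    complement.\<close>
  have gens: "{F ((e \<circ> \<iota>) a) ((e \<circ> \<iota>) b) | a b. a \<in> carrier A \<and> b \<in> carrier A}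
      = {F (e a) (e b) | a b. a \<in> carrier B \<and> b \<in> carrier B}" for F :: "'d \<Rightarrow> 'd \<Rightarrow> 'd"
    unfolding im[symmetric] by auto
  show ?thesis
    using assms(1) emb ext cl
      gens[of "\<lambda>x y. x \<otimes>\<^bsub>D\<^esub> bcompl D y"] gens[of "\<lambda>x y. x \<oplus>\<^bsub>D\<^esub> bcompl D y"]
    by (simp add: comm_admissible_Delta1_extension_def)
qed

theorem mainTheorem5:
  fixes A :: "'a bimonoid" and B :: "'b bimonoid"
    and Abar :: "'c bimonoid" and Bbar :: "'d bimonoid"
    and \<iota> :: "'a \<Rightarrow> 'b" and eA :: "'a \<Rightarrow> 'c" and eB :: "'b \<Rightarrow> 'd"
  assumes "comm_bimonoid A" and "comm_bimonoid B"
    and "bimonoid_iso A B \<iota>"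
    and "comm_admissible_Delta1_extension A Abar eA"
    and "comm_admissible_Delta1_extension B Bbar eB"
    and "complete_bimonoid Bbar" and "complemented Bbar"
  shows "\<exists>!f. f \<in> extensional (carrier Abar) \<and> complete_embedding Abar Bbar f \<and>
           (\<forall>a\<in>carrier A. f (eA a) = eB (\<iota> a))"
proof -
  interpret two_Delta1_extensions A Abar eA Bbar "eB \<circ> \<iota>"
    using assms(4) Delta1_extension_comp_iso[OF assms(1,3,5)]
    by (simp add: two_Delta1_extensions_def Delta1_extension_def)
  show ?thesis
    using ex1_complete_embedding[OF assms(6)] by simp
qed

end
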